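(* Assume $S_1$ and $S_2$ are spherical rigid bodies ($C_1=A_1$, $C_2=A_2$; zero order approximate dynamics), and fix $|\lambda^e|>0$. Let $\rho$ be the unique root in $(-\infty,-1)$ of $$(m_1+m_2)\rho^5+(3m_2+2m_1)\rho^4+(3m_2+m_1)\rho^3+(3m_0+2m_2+m_1)\rho^2+(3m_0+2m_1)\rho+(m_0+m_1)=0,$$ and let $\mathbf z_e$ be the corresponding (only) Eulerian relative equilibrium in the configuration $S_0S_2S_1$: $$\lambda^e=(\lambda^e,0,0),\quad \mu^e=(\mu^e,0,0),\quad \Omega_0^e=(0,0,\omega_0^e),\quad p_\lambda^e=(0,g_1\omega_0^e\lambda^e,0),\quad p_\mu^e=(0,g_2\omega_0^e\mu^e,0),\quad \Pi_0^e=(0,0,C_0\omega_0^e+l),$$ with $\mu^e=\frac{(1+\rho)m_2+\rho m_1}{M_2}\lambda^e$ (same letters for vectors and their first components), $\Pi_i^e\times\Omega_i^e=0$ $(i=1,2)$ and $$(\omega_0^e)^2=\frac{G(m_1+m_2)}{|\lambda^e|^3}\Big(1+\frac{m_0}{m_1+m_2}\Big(\frac1{\rho^2}-\frac1{(1+\rho)^2}\Big)\Big).$$ Then $\mathbf z_e$ is an unstable equilibrium of the equations of motion.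
   Context: Setting. $G>0$; $m_0,m_1,m_2>0$ are the masses of a gyrostat $S_0$ and two symmetric rigid bodies $S_1,S_2$. Put $M_2=m_1+m_2$, $M_1=m_0+m_1+m_2$, $g_1=m_1m_2/M_2$, $g_2=m_0M_2/M_1$. Inertia tensors: $\mathbb I_i=\mathrm{diag}(A_i,A_i,C_i)$, $A_i,C_i>0$, $i=0,1,2$. The gyrostatic momentum is the constant vector $l_r=(0,0,l)$. The state is $\mathbf z=(\Pi_1,\Pi_2,\Pi_0,\lambda,p_\lambda,\mu,p_\mu)\in\mathbb R^{21}$ (seven vectors of $\mathbb R^3$), with $\Pi_0=\mathbb I_0\Omega_0+l_r$ and $\Pi_i=\mathbb I_i\Omega_i$ ($i=1,2$). Put $x_1=\mu-\frac{m_2}{M_2}\lambda$, $x_2=\mu+\frac{m_1}{M_2}\lambda$ (the vectors from $S_1$, respectively $S_2$, to $S_0$). When $C_1=A_1$, $C_2=A_2$ the potential is $$\mathcal V=-\Big(\frac{Gm_1m_2}{|\lambda|}+\frac{Gm_1m_0}{|x_1|}+\frac{Gm_2m_0}{|x_2|}\Big),\qquad \lambda,x_1,x_2\neq0 .$$ The equations of motion are $$\dot\Pi_0=\Pi_0\times\Omega_0+\lambda\times\nabla_\lambda\mathcal V+\mu\times\nabla_\mu\mathcal V,$$ $$\dot\lambda=\frac{p_\lambda}{g_1}+\lambda\times\Omega_0,\quad \dot p_\lambda=p_\lambda\times\Omega_0-\nabla_\lambda\mathcal V,\quad \dot\mu=\frac{p_\mu}{g_2}+\mu\times\Omega_0,\quad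 \dot p_\mu=p_\mu\times\Omega_0-\nabla_\mu\mathcal V,$$ $$\dot\Pi_1=\Pi_1\times\Omega_1,\quad \dot\Pi_2=\Pi_2\times\Omega_2 .$$ A relative equilibrium is an equilibrium point of these equations; it is Eulerian if $\lambda^e$ and $\mu^e$ are proportional and $\Omega_0^e$ is perpendicular to the line they generate. The configuration $S_0S_2S_1$ means the bodies lie on the line in this order. *)

theory Defs
  imports "HOL-Analysis.Analysis"
begin

unbundle cross3_syntax

section \<open>Equilibria and Lyapunov stability of autonomous differential equations\<close>

definition is_solution ::
  "('a::real_normed_vector \<Rightarrow> 'a) \<Rightarrow> 'a set \<Rightarrow> real \<Rightarrow> (real \<Rightarrow> 'a) \<Rightarrow> bool" where
  "is_solution f D T z \<longleftrightarrow>
     (\<forall>t\<in>{0..<T}. z t \<in> D \<and> (z has_vector_derivative f (z t)) (at t within {0..<T}))"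

definition equilibrium :: "('a::real_normed_vector \<Rightarrow> 'a) \<Rightarrow> 'a set \<Rightarrow> 'a \<Rightarrow> bool" where
  "equilibrium f D e \<longleftrightarrow> e \<in> D \<and> f e = 0"

text \<open>
  All solutions on intervals \<open>[0,T)\<close> are considered, including those that cannot be continued to
  \<open>[0,\<infinity>)\<close>. For a locally Lipschitz field on an open subset of a Euclidean space this agrees with
  the usual definition, since a solution confined to a compact subset of the domain can be
  continued for all times.
\<close>

definition lyapunov_stable :: "('a::real_normed_vector \<Rightarrow> 'a) \<Rightarrow> 'a set \<Rightarrow> 'a \<Rightarrow> bool" where
  "lyapunov_stable f D e \<longleftrightarrow>
     (\<forall>\<epsilon>>0. \<exists>\<delta>>0. \<forall>T z. is_solution f D T z \<and> dist (z 0) e < \<delta> \<longrightarrow>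
        (\<forall>t\<in>{0..<T}. dist (z t) e < \<epsilon>))"

definition unstable_equilibrium :: "('a::real_normed_vector \<Rightarrow> 'a) \<Rightarrow> 'a set \<Rightarrow> 'a \<Rightarrow> bool" where
  "unstable_equilibrium f D e \<longleftrightarrow> equilibrium f D e \<and> \<not> lyapunov_stable f D e"

text \<open>Meaningful only where \<open>f\<close> is differentiable.\<close>

definition gradient :: "('a::real_inner \<Rightarrow> real) \<Rightarrow> 'a \<Rightarrow> 'a" where
  "gradient f x = (THE D. GDERIV f x :> D)"


section \<open>A gyrostat and two symmetric rigid bodies\<close>

text \<open>
  A state is \<open>(\<Pi>\<^sub>1, \<Pi>\<^sub>2, \<Pi>\<^sub>0, \<lambda>, p\<^sub>\<lambda>, \<mu>, p\<^sub>\<mu>)\<close>,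
  below \<open>(Pi1, Pi2, Pi0, la, pla, mu, pmu)\<close>.
\<close>

type_synonym state =
  "(real^3) \<times> (real^3) \<times> (real^3) \<times> (real^3) \<times> (real^3) \<times> (real^3) \<times> (real^3)"

definition red_mass1 :: "real \<Rightarrow> real \<Rightarrow> real" where
  "red_mass1 m1 m2 = m1 * m2 / (m1 + m2)"

definition red_mass2 :: "real \<Rightarrow> real \<Rightarrow> real \<Rightarrow> real" where
  "red_mass2 m0 m1 m2 = m0 * (m1 + m2) / (m0 + m1 + m2)"

definition inertia_tensor :: "real \<Rightarrow> real \<Rightarrow> real^3^3" where
  "inertia_tensor A C = vector [vector [A, 0, 0], vector [0, A, 0], vector [0, 0, C]]"

text \<open>
  The solution \<open>\<Omega>\<close> of \<open>P = \<I> \<Omega> + (0,0,l)\<close>; for a rigid body \<open>l = 0\<close>.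
\<close>

definition ang_vel :: "real \<Rightarrow> real \<Rightarrow> real \<Rightarrow> real^3 \<Rightarrow> real^3" where
  "ang_vel A C l P = matrix_inv (inertia_tensor A C) *v (P - vector [0, 0, l])"

text \<open>The vectors to the gyrostat \<open>S\<^sub>0\<close> from \<open>S\<^sub>1\<close> and from \<open>S\<^sub>2\<close>.\<close>

definition x1_vec :: "real \<Rightarrow> real \<Rightarrow> real^3 \<Rightarrow> real^3 \<Rightarrow> real^3" where
  "x1_vec m1 m2 la mu = mu - (m2 / (m1 + m2)) *\<^sub>R la"

definition x2_vec :: "real \<Rightarrow> real \<Rightarrow> real^3 \<Rightarrow> real^3 \<Rightarrow> real^3" where
  "x2_vec m1 m2 la mu = mu + (m1 / (m1 + m2)) *\<^sub>R la"

text \<open>The zero order potential; it presupposes that both rigid bodies are spherical.\<close>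

definition potential ::
  "real \<Rightarrow> real \<Rightarrow> real \<Rightarrow> real \<Rightarrow> real^3 \<Rightarrow> real^3 \<Rightarrow> real" where
  "potential G m0 m1 m2 la mu =
     - (G * m1 * m2 / norm la
        + G * m1 * m0 / norm (x1_vec m1 m2 la mu)
        + G * m2 * m0 / norm (x2_vec m1 m2 la mu))"

definition phase_space :: "real \<Rightarrow> real \<Rightarrow> state set" where
  "phase_space m1 m2 =
     {(Pi1, Pi2, Pi0, la, pla, mu, pmu).
        la \<noteq> 0 \<and> x1_vec m1 m2 la mu \<noteq> 0 \<and> x2_vec m1 m2 la mu \<noteq> 0}"

definition motion_field ::
  "real \<Rightarrow> real \<Rightarrow> real \<Rightarrow> real \<Rightarrow> real \<Rightarrow> real \<Rightarrow> real \<Rightarrow> real \<Rightarrow> real \<Rightarrow> real \<Rightarrow> real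
    \<Rightarrow> state \<Rightarrow> state" where
  "motion_field G m0 m1 m2 A0 C0 A1 C1 A2 C2 l = (\<lambda>(Pi1, Pi2, Pi0, la, pla, mu, pmu).
     let \<Omega>0 = ang_vel A0 C0 l Pi0;
         \<Omega>1 = ang_vel A1 C1 0 Pi1;
         \<Omega>2 = ang_vel A2 C2 0 Pi2;
         dV_la = gradient (\<lambda>x. potential G m0 m1 m2 x mu) la;
         dV_mu = gradient (\<lambda>x. potential G m0 m1 m2 la x) mu
     in (Pi1 \<times> \<Omega>1,
         Pi2 \<times> \<Omega>2,
         Pi0 \<times> \<Omega>0 + la \<times> dV_la + mu \<times> dV_mu,
         pla /\<^sub>R red_mass1 m1 m2 + la \<times> \<Omega>0,
         pla \<times> \<Omega>0 - dV_la,
         pmu /\<^sub>R red_mass2 m0 m1 m2 + mu \<times> \<Omega>0,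
         pmu \<times> \<Omega>0 - dV_mu))"

definition eulerian_relative_equilibrium ::
  "real \<Rightarrow> real \<Rightarrow> real \<Rightarrow> real \<Rightarrow> real \<Rightarrow> real \<Rightarrow> real \<Rightarrow> real \<Rightarrow> real \<Rightarrow> real \<Rightarrow> real
    \<Rightarrow> state \<Rightarrow> bool" where
  "eulerian_relative_equilibrium G m0 m1 m2 A0 C0 A1 C1 A2 C2 l =
     (\<lambda>z. equilibrium (motion_field G m0 m1 m2 A0 C0 A1 C1 A2 C2 l) (phase_space m1 m2) z \<and>
        (case z of (Pi1, Pi2, Pi0, la, pla, mu, pmu) \<Rightarrow>
           collinear {0, la, mu} \<and>
           orthogonal (ang_vel A0 C0 l Pi0) la \<and> orthogonal (ang_vel A0 C0 l Pi0) mu))"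

text \<open>
  Seen from \<open>S\<^sub>0\<close>, the bodies \<open>S\<^sub>1\<close> and \<open>S\<^sub>2\<close> are at \<open>- x\<^sub>1\<close> and \<open>- x\<^sub>2\<close>.
\<close>

definition configuration_S0_S2_S1 :: "real \<Rightarrow> real \<Rightarrow> state \<Rightarrow> bool" where
  "configuration_S0_S2_S1 m1 m2 = (\<lambda>(Pi1, Pi2, Pi0, la, pla, mu, pmu).
     - x2_vec m1 m2 la mu \<in> open_segment 0 (- x1_vec m1 m2 la mu))"

definition euler_quintic :: "real \<Rightarrow> real \<Rightarrow> real \<Rightarrow> real \<Rightarrow> real" where
  "euler_quintic m0 m1 m2 \<rho> =
     (m1 + m2) * \<rho>^5 + (3*m2 + 2*m1) * \<rho>^4 + (3*m2 + m1) * \<rho>^3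
     + (3*m0 + 2*m2 + m1) * \<rho>^2 + (3*m0 + 2*m1) * \<rho> + (m0 + m1)"

lemma euler_quintic_unique_root:
  assumes m: "m0 > 0" "m1 > 0" "m2 > 0"
  shows "\<exists>!\<rho>. \<rho> < -1 \<and> euler_quintic m0 m1 m2 \<rho> = 0"
proof -
  define a where "a t = (m1+m2)*t^2 + (2*m2+3*m1)*t + (m2+3*m1)" for t :: real
  define b where "b t = (m2+3*m0)*t^2 + (2*m2+3*m0)*t + (m2+m0)" for t :: real
  have q: "euler_quintic m0 m1 m2 (-1-t) = b t - t^3 * a t" for t
    unfolding euler_quintic_def a_def b_def by algebra
  have no: False if st: "0 < s" "s < t" and z: "b s = s^3 * a s" "b t = t^3 * a t" for s t
  proof -
    have a1: "a s < a t" and a0: "0 < a s"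
      unfolding a_def using st m
      by (auto intro!: add_strict_mono mult_strict_left_mono power_strict_mono add_pos_pos)
    have "s^3 * b t = s^3*t^3 * a t" using z by simp
    also have "\<dots> > s^3*t^3 * a s" using a1 st by simp
    also have "s^3*t^3 * a s = t^3 * b s" using z by simp
    finally have 1: "s^3 * b t > t^3 * b s" .
    have "t^3 * b s - s^3 * b t =
        (m2+3*m0)*(s^2*t^2)*(t-s) + (2*m2+3*m0)*(s*t)*(t^2-s^2) + (m2+m0)*(t^3-s^3)"
      unfolding b_def by algebra
    moreover have "s^2 < t^2" "s^3 < t^3" using st by (auto intro: power_strict_mono)
    ultimately have "t^3 * b s - s^3 * b t > 0"
      using st m by (auto intro!: add_pos_pos mult_pos_pos)
    with 1 show False by simp
  qed
  have "\<exists>t>0. b t = t^3 * a t"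
  proof -
    define T where "T = 2 + m0 / m1"
    have T: "T > 1" "m0 < m1 * T" using m by (auto simp: T_def field_simps)
    have "b T \<le> (m2+3*m0)*T^2 + (2*m2+3*m0)*T^2 + (m2+m0)*T^2"
    proof -
      have "1 \<le> T^2" "T \<le> T^2" using T by (auto simp: one_le_power self_le_power)
      then show ?thesis unfolding b_def using m
        by (intro add_mono mult_left_mono) auto
    qed
    also have "\<dots> = T^2 * (4*m2 + 7*m0)" by algebra
    also have "\<dots> \<le> T^2 * (T * a T)"
    proof -
      have "4 * m2 \<le> T * ((m1+m2)*T^2 + (2*m2)*T + m2) - m1*T^3"
      proof -
        have "1 \<le> T" "1 \<le> T^2" "1 \<le> T^3" using T by (auto simp: one_le_power)
        then have "m2*1 \<le> m2*T^3" "m2*1 \<le> m2*T^2" "m2*1 \<le> m2*T"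
          using m by (auto intro!: mult_left_mono)
        moreover have "T * ((m1+m2)*T^2 + (2*m2)*T + m2) - m1*T^3 = m2*T^3 + 2*(m2*T^2) + m2*T"
          by algebra
        ultimately show ?thesis by linarith
      qed
      moreover have "7 * m0 \<le> m1*T^3 + 3*m1*T^2 + 3*m1*T"
      proof -
        have "m1*T*1 \<le> m1*T*T^2" "m1*T*1 \<le> m1*T*T" using m T
          by (auto intro!: mult_left_mono simp: one_le_power)
        then have "m1*T \<le> m1*T^3" "m1*T \<le> m1*T^2"
          by (auto simp: power2_eq_square power3_eq_cube algebra_simps)
        with T show ?thesis by linarith
      qed
      moreover have "T * a T = T * ((m1+m2)*T^2 + (2*m2)*T + m2) - m1*T^3
          + (m1*T^3 + 3*m1*T^2 + 3*m1*T)"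
        unfolding a_def by algebra
      ultimately show ?thesis by (intro mult_left_mono) auto
    qed
    finally have T2: "b T - T^3 * a T \<le> 0"
      by (simp add: power2_eq_square power3_eq_cube mult.assoc)
    have "continuous_on {0..T} (\<lambda>t. b t - t^3 * a t)"
      unfolding a_def b_def by (intro continuous_intros)
    moreover have "b 0 - 0^3 * a 0 > 0" using m by (simp add: b_def)
    ultimately obtain t where "0 \<le> t" "t \<le> T" "b t - t^3 * a t = 0"
      using IVT2'[of "\<lambda>t. b t - t^3 * a t" T 0 0] T T2 by auto
    moreover from this have "t \<noteq> 0" using m by (auto simp: b_def)
    ultimately show ?thesis by (intro exI[of _ t]) auto
  qed
  then obtain t where t: "t > 0" "b t = t^3 * a t" by blast
  show ?thesis
  proof (rule ex1I[of _ "-1-t"])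
    show "-1-t < -1 \<and> euler_quintic m0 m1 m2 (-1-t) = 0" using t q by simp
  next
    fix r assume r: "r < -1 \<and> euler_quintic m0 m1 m2 r = 0"
    define s where "s = -1-r"
    have "r = -1-s" "s > 0" using r by (auto simp: s_def)
    then have "b s = s^3 * a s" using q[of s] r by simp
    then have "s = t" using no[of s t] no[of t s] t \<open>s > 0\<close> by (meson linorder_neqE_linordered_idom)
    then show "r = -1-t" using \<open>r = -1-s\<close> by simp
  qed
qed

end

theory Submission
  imports Defs
begin

text \<open>
  The orbital motion does not feel the spin of the gyrostat: the potential depends only on mutual
  distances, so no torque acts on \<open>S\<^sub>0\<close>, and if \<open>\<Pi>\<^sub>0\<close> starts at its equilibrium value,
  it stays there. The axes fixed in \<open>S\<^sub>0\<close>, in which positions are measured, then turn at the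
  fixed rate \<open>\<omega>\<^sub>0\<^sup>e\<close>, whatever the three bodies do.

  In inertial axes, on the other hand, the Euler configuration moves on a circle of any size:
  Newtonian forces scale like the inverse square of the length, so the configuration enlarged by the
  factor \<open>k\<^sup>2\<close> moves on a circle at the rate \<open>\<omega>\<^sub>0\<^sup>e / k\<^sup>3\<close> (Kepler's third law). Seen from
  \<open>S\<^sub>0\<close>, this orbit turns at the rate \<open>\<omega>\<^sub>0\<^sup>e / k\<^sup>3 - \<omega>\<^sub>0\<^sup>e\<close>, which for \<open>k \<noteq> 1\<close> is
  not zero. So solutions starting arbitrarily close to the equilibrium drift, slowly but steadily,
  until the line of the bodies has made half a turn and \<open>\<lambda>\<close> points away from \<open>\<lambda>\<^sup>e\<close>.

  The circular orbits form the family \<open>circular_state\<close>. The field along it is computed in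
  \<open>motion_field_circular\<close>, which rests on the value of the gradients of the potential at an Euler
  configuration (\<open>gradient_la_Euler\<close>, \<open>gradient_mu_Euler\<close>). The quintic enters through
  \<open>Euler_force_balance\<close>, as the condition that both gradients demand the same angular velocity. The
  equilibrium itself is the circular orbit that keeps pace with the axes.
\<close>

section \<open>Gradients of the Newtonian potential\<close>

lemma gradient_eqI:
  assumes "GDERIV f x :> D"
  shows "gradient f x = D"
  unfolding gradient_def
proof (rule the_equality[where P = "\<lambda>D. GDERIV f x :> D"])
  fix E assume "GDERIV f x :> E"
  with assms have "(\<lambda>h. h \<bullet> E) = (\<lambda>h. h \<bullet> D)"
    unfolding gderiv_def by (rule has_derivative_unique[rotated])
  then show "E = D" by (metis vector_eq_ldot)
qed (fact assms)

lemma GDERIV_inverse_distance: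
  fixes x b :: "'a::real_inner"
  assumes "a *\<^sub>R x + b \<noteq> 0"
  shows "GDERIV (\<lambda>x. c / norm (a *\<^sub>R x + b)) x
    :> (- (c * a) / norm (a *\<^sub>R x + b) ^ 3) *\<^sub>R (a *\<^sub>R x + b)"
proof -
  have "((\<lambda>x. norm (a *\<^sub>R x + b)) has_derivative (\<lambda>h. (a *\<^sub>R h) \<bullet> sgn (a *\<^sub>R x + b))) (at x)"
    by (rule has_derivative_compose[where f = "\<lambda>x. a *\<^sub>R x + b" and g = norm,
          OF _ has_derivative_norm[OF assms]])
       (auto intro!: derivative_eq_intros)
  then have "GDERIV (\<lambda>x. norm (a *\<^sub>R x + b)) x :> a *\<^sub>R sgn (a *\<^sub>R x + b)"
    unfolding gderiv_def by (simp add: inner_commute)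
  moreover have "DERIV (\<lambda>r. c / r) (norm (a *\<^sub>R x + b)) :> - c / norm (a *\<^sub>R x + b) ^ 2"
    using assms by (auto intro!: derivative_eq_intros simp: power2_eq_square)
  ultimately have "GDERIV (\<lambda>x. c / norm (a *\<^sub>R x + b)) x
      :> (- c / norm (a *\<^sub>R x + b) ^ 2) *\<^sub>R a *\<^sub>R sgn (a *\<^sub>R x + b)"
    by (rule GDERIV_DERIV_compose)
  then show ?thesis
    by (rule GDERIV_subst)
       (simp add: sgn_div_norm power2_eq_square power3_eq_cube divide_simps)
qed

lemma gradient_la_potential:
  assumes "la \<noteq> 0" "x1_vec m1 m2 la mu \<noteq> 0" "x2_vec m1 m2 la mu \<noteq> 0"
  shows "gradient (\<lambda>x. potential G m0 m1 m2 x mu) la =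
    (G * m1 * m2 / norm la ^ 3) *\<^sub>R la
    - (G * m1 * m0 * (m2 / (m1 + m2)) / norm (x1_vec m1 m2 la mu) ^ 3) *\<^sub>R x1_vec m1 m2 la mu
    + (G * m2 * m0 * (m1 / (m1 + m2)) / norm (x2_vec m1 m2 la mu) ^ 3) *\<^sub>R x2_vec m1 m2 la mu"
proof -
  have x: "x1_vec m1 m2 x mu = (- (m2 / (m1 + m2))) *\<^sub>R x + mu"
    "x2_vec m1 m2 x mu = (m1 / (m1 + m2)) *\<^sub>R x + mu" for x
    by (simp_all add: x1_vec_def x2_vec_def)
  have d0: "GDERIV (\<lambda>x. G * m1 * m2 / norm x) la :> - (G * m1 * m2 / norm la ^ 3) *\<^sub>R la"
    using GDERIV_inverse_distance[of 1 la 0 "G * m1 * m2"] assms(1) by simp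
  note d1 = GDERIV_inverse_distance[OF assms(2)[unfolded x], of "G * m1 * m0"]
  note d2 = GDERIV_inverse_distance[OF assms(3)[unfolded x], of "G * m2 * m0"]
  show ?thesis
    unfolding potential_def x
    by (rule gradient_eqI, rule GDERIV_subst,
        rule GDERIV_minus[OF GDERIV_add[OF GDERIV_add[OF d0 d1] d2]])
       (simp add: scaleR_minus_left[symmetric] del: scaleR_minus_left)
qed

lemma gradient_mu_potential:
  assumes "x1_vec m1 m2 la mu \<noteq> 0" "x2_vec m1 m2 la mu \<noteq> 0"
  shows "gradient (\<lambda>x. potential G m0 m1 m2 la x) mu =
    (G * m1 * m0 / norm (x1_vec m1 m2 la mu) ^ 3) *\<^sub>R x1_vec m1 m2 la mu
    + (G * m2 * m0 / norm (x2_vec m1 m2 la mu) ^ 3) *\<^sub>R x2_vec m1 m2 la mu"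
proof -
  have x: "x1_vec m1 m2 la x = 1 *\<^sub>R x + (- (m2 / (m1 + m2)) *\<^sub>R la)"
    "x2_vec m1 m2 la x = 1 *\<^sub>R x + (m1 / (m1 + m2)) *\<^sub>R la" for x
    by (simp_all add: x1_vec_def x2_vec_def)
  note d0 = GDERIV_const[of "G * m1 * m2 / norm la" mu]
  note d1 = GDERIV_inverse_distance[OF assms(1)[unfolded x], of "G * m1 * m0"]
  note d2 = GDERIV_inverse_distance[OF assms(2)[unfolded x], of "G * m2 * m0"]
  show ?thesis
    unfolding potential_def x
    by (rule gradient_eqI, rule GDERIV_subst,
        rule GDERIV_minus[OF GDERIV_add[OF GDERIV_add[OF d0 d1] d2]]) simp
qed

section \<open>The Euler configuration\<close>

text \<open>
  In an Euler configuration \<open>\<mu> = \<kappa> \<lambda>\<close> with the ratio \<open>\<kappa>\<close> chosen so that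
  \<open>x\<^sub>1 = \<rho> \<lambda>\<close> and \<open>x\<^sub>2 = (1 + \<rho>) \<lambda>\<close>.
\<close>

definition Euler_ratio :: "real \<Rightarrow> real \<Rightarrow> real \<Rightarrow> real" where
  "Euler_ratio m1 m2 \<rho> = ((1 + \<rho>) * m2 + \<rho> * m1) / (m1 + m2)"

text \<open>
  This is the constant of Kepler's third law: the circular motion of the configuration with angular
  velocity \<open>w\<close> and \<open>|\<lambda>| = r\<close> satisfies \<open>w\<^sup>2 r\<^sup>3 =\<close> \<open>Kepler_const\<close>.
\<close>

definition Kepler_const :: "real \<Rightarrow> real \<Rightarrow> real \<Rightarrow> real \<Rightarrow> real \<Rightarrow> real" where
  "Kepler_const G m0 m1 m2 \<rho> =
     G * (m1 + m2) * (1 + m0 / (m1 + m2) * (1 / \<rho>\<^sup>2 - 1 / (1 + \<rho>)\<^sup>2))"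

lemma x_vec_Euler:
  assumes "m1 + m2 \<noteq> 0"
  shows "x1_vec m1 m2 v (Euler_ratio m1 m2 \<rho> *\<^sub>R v) = \<rho> *\<^sub>R v"
    and "x2_vec m1 m2 v (Euler_ratio m1 m2 \<rho> *\<^sub>R v) = (1 + \<rho>) *\<^sub>R v"
proof -
  have "Euler_ratio m1 m2 \<rho> = \<rho> + m2 / (m1 + m2)"
    "Euler_ratio m1 m2 \<rho> = (1 + \<rho>) - m1 / (m1 + m2)"
    using assms by (simp_all add: Euler_ratio_def field_simps)
  then show "x1_vec m1 m2 v (Euler_ratio m1 m2 \<rho> *\<^sub>R v) = \<rho> *\<^sub>R v"
    "x2_vec m1 m2 v (Euler_ratio m1 m2 \<rho> *\<^sub>R v) = (1 + \<rho>) *\<^sub>R v"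
    by (simp_all add: x1_vec_def x2_vec_def flip: scaleR_diff_left scaleR_add_left)
qed

text \<open>
  The quintic is the balance of forces on the line, cleared of denominators: it makes the circular
  motion of \<open>\<mu>\<close> have the same Kepler constant as that of \<open>\<lambda>\<close>.
\<close>

lemma Euler_force_balance:
  assumes m: "m0 > 0" "m1 > 0" "m2 > 0"
    and \<rho>: "\<rho> < -1" "euler_quintic m0 m1 m2 \<rho> = 0"
  shows "red_mass2 m0 m1 m2 * Kepler_const G m0 m1 m2 \<rho> * Euler_ratio m1 m2 \<rho> =
    - (G * m0) * (m1 / \<rho>\<^sup>2 + m2 / (1 + \<rho>)\<^sup>2)"
proof -
  define M2 M1 where "M2 = m1 + m2" and "M1 = m0 + m1 + m2"
  have pos: "M2 > 0" "M1 > 0" "\<rho> \<noteq> 0" "1 + \<rho> \<noteq> 0"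
    using m \<rho> by (auto simp: M2_def M1_def)
  have "(M2 * \<rho>\<^sup>2 * (1 + \<rho>)\<^sup>2 + m0 * ((1 + \<rho>)\<^sup>2 - \<rho>\<^sup>2)) * ((1 + \<rho>) * m2 + \<rho> * m1)
      + M1 * (m1 * (1 + \<rho>)\<^sup>2 + m2 * \<rho>\<^sup>2) = M2 * euler_quintic m0 m1 m2 \<rho>"
    unfolding M2_def M1_def euler_quintic_def by algebra
  then have key: "(M2 * \<rho>\<^sup>2 * (1 + \<rho>)\<^sup>2 + m0 * ((1 + \<rho>)\<^sup>2 - \<rho>\<^sup>2)) * ((1 + \<rho>) * m2 + \<rho> * m1)
      = - M1 * (m1 * (1 + \<rho>)\<^sup>2 + m2 * \<rho>\<^sup>2)"
    using \<rho> by simp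
  have "red_mass2 m0 m1 m2 * Kepler_const G m0 m1 m2 \<rho> * Euler_ratio m1 m2 \<rho> =
      G * m0 / M1 / (\<rho>\<^sup>2 * (1 + \<rho>)\<^sup>2) *
      ((M2 * \<rho>\<^sup>2 * (1 + \<rho>)\<^sup>2 + m0 * ((1 + \<rho>)\<^sup>2 - \<rho>\<^sup>2)) * ((1 + \<rho>) * m2 + \<rho> * m1))"
  proof -
    have "1 + m0 / M2 * (1 / \<rho>\<^sup>2 - 1 / (1 + \<rho>)\<^sup>2) =
        (M2 * \<rho>\<^sup>2 * (1 + \<rho>)\<^sup>2 + m0 * ((1 + \<rho>)\<^sup>2 - \<rho>\<^sup>2)) / (M2 * (\<rho>\<^sup>2 * (1 + \<rho>)\<^sup>2))"
      using pos by (simp add: field_simps)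
    then show ?thesis
      unfolding red_mass2_def Kepler_const_def Euler_ratio_def
        M2_def[symmetric] M1_def[symmetric]
      using pos by simp
  qed
  also have "\<dots> = - (G * m0) * (m1 / \<rho>\<^sup>2 + m2 / (1 + \<rho>)\<^sup>2)"
    unfolding key using pos by (simp add: field_simps)
  finally show ?thesis .
qed

text \<open>
  The sign of the force along the line is decided by the order of the bodies: \<open>\<rho> < -1\<close> makes
  both \<open>x\<^sub>1\<close> and \<open>x\<^sub>2\<close> point against \<open>\<lambda>\<close>.
\<close>

lemma attraction_along_line:
  fixes v :: "'a::real_normed_vector"
  assumes "\<sigma> < 0"
  shows "(c / norm (\<sigma> *\<^sub>R v) ^ 3) *\<^sub>R (\<sigma> *\<^sub>R v) = (- (c / \<sigma>\<^sup>2) / norm v ^ 3) *\<^sub>R v"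
proof -
  have "(- \<sigma> * norm v) ^ 3 = - (\<sigma> * \<sigma>\<^sup>2 * norm v ^ 3)"
    by (simp add: power2_eq_square power3_eq_cube)
  then show ?thesis using assms by simp
qed

lemma gradient_la_Euler:
  assumes m: "m1 > 0" "m2 > 0" and \<rho>: "\<rho> < -1" and v: "v \<noteq> 0"
  shows "gradient (\<lambda>x. potential G m0 m1 m2 x (Euler_ratio m1 m2 \<rho> *\<^sub>R v)) v =
    (red_mass1 m1 m2 * Kepler_const G m0 m1 m2 \<rho> / norm v ^ 3) *\<^sub>R v"
proof -
  have M: "m1 + m2 \<noteq> 0" using m by simp
  note x = x_vec_Euler[OF M]
  have "gradient (\<lambda>x. potential G m0 m1 m2 x (Euler_ratio m1 m2 \<rho> *\<^sub>R v)) v =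
      (G * m1 * m2 / norm v ^ 3) *\<^sub>R v
      - (- (G * m1 * m0 * (m2 / (m1 + m2)) / \<rho>\<^sup>2) / norm v ^ 3) *\<^sub>R v
      + (- (G * m2 * m0 * (m1 / (m1 + m2)) / (1 + \<rho>)\<^sup>2) / norm v ^ 3) *\<^sub>R v"
    using \<rho> v
    by (subst gradient_la_potential) (simp_all only: x attraction_along_line, simp_all)
  also have "\<dots> = ((G * m1 * m2 + G * m1 * m0 * (m2 / (m1 + m2)) / \<rho>\<^sup>2
      - G * m2 * m0 * (m1 / (m1 + m2)) / (1 + \<rho>)\<^sup>2) / norm v ^ 3) *\<^sub>R v"
    by (simp add: scaleR_add_left scaleR_diff_left add_divide_distrib diff_divide_distrib)
  also have "G * m1 * m2 + G * m1 * m0 * (m2 / (m1 + m2)) / \<rho>\<^sup>2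
      - G * m2 * m0 * (m1 / (m1 + m2)) / (1 + \<rho>)\<^sup>2 = red_mass1 m1 m2 * Kepler_const G m0 m1 m2 \<rho>"
  proof -
    define p q where "p = 1 / \<rho>\<^sup>2" and "q = 1 / (1 + \<rho>)\<^sup>2"
    have "G * m1 * m2 + G * m1 * m0 * (m2 / (m1 + m2)) * p
        - G * m2 * m0 * (m1 / (m1 + m2)) * q =
        m1 * m2 / (m1 + m2) * (G * (m1 + m2) * (1 + m0 / (m1 + m2) * (p - q)))"
      using M by (simp add: field_simps)
    then show ?thesis by (simp add: red_mass1_def Kepler_const_def p_def q_def)
  qed
  finally show ?thesis .
qed

lemma gradient_mu_Euler:
  assumes m: "m0 > 0" "m1 > 0" "m2 > 0"
    and \<rho>: "\<rho> < -1" "euler_quintic m0 m1 m2 \<rho> = 0" and v: "v \<noteq> 0"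
  shows "gradient (\<lambda>x. potential G m0 m1 m2 v x) (Euler_ratio m1 m2 \<rho> *\<^sub>R v) =
    (red_mass2 m0 m1 m2 * Kepler_const G m0 m1 m2 \<rho> * Euler_ratio m1 m2 \<rho> / norm v ^ 3) *\<^sub>R v"
proof -
  have M: "m1 + m2 \<noteq> 0" using m by simp
  note x = x_vec_Euler[OF M]
  have "gradient (\<lambda>x. potential G m0 m1 m2 v x) (Euler_ratio m1 m2 \<rho> *\<^sub>R v) =
      (- (G * m1 * m0 / \<rho>\<^sup>2) / norm v ^ 3) *\<^sub>R v
      + (- (G * m2 * m0 / (1 + \<rho>)\<^sup>2) / norm v ^ 3) *\<^sub>R v"
    using \<rho> v
    by (subst gradient_mu_potential) (simp_all only: x attraction_along_line, simp_all)
  also have "\<dots> = (- (G * m0) * (m1 / \<rho>\<^sup>2 + m2 / (1 + \<rho>)\<^sup>2) / norm v ^ 3) *\<^sub>R v"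
    unfolding scaleR_add_left[symmetric]
    by (rule arg_cong[where f = "\<lambda>c. c *\<^sub>R v"])
       (simp add: add_divide_distrib diff_divide_distrib algebra_simps)
  finally show ?thesis using Euler_force_balance[OF m \<rho>, of G] by simp
qed

section \<open>Circular orbits in axes fixed in the gyrostat\<close>

lemma ang_vel_eq:
  assumes "A \<noteq> 0" "C \<noteq> 0"
  shows "ang_vel A C l P = vector [P$1 / A, P$2 / A, (P$3 - l) / C]"
proof -
  define B :: "real^3^3" where
    "B = vector [vector [1/A, 0, 0], vector [0, 1/A, 0], vector [0, 0, 1/C]]"
  have B: "inertia_tensor A C ** B = mat 1" "B ** inertia_tensor A C = mat 1"
    using assms
    by (simp_all add: inertia_tensor_def B_def matrix_matrix_mult_def mat_def vec_eq_iff
        forall_3 sum_3)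
  have "matrix_inv (inertia_tensor A C) = B"
    unfolding matrix_inv_def
  proof (rule some_equality)
    fix B' assume "inertia_tensor A C ** B' = mat 1 \<and> B' ** inertia_tensor A C = mat 1"
    then show "B' = B" using B by (metis matrix_mul_assoc matrix_mul_lid matrix_mul_rid)
  qed (use B in blast)
  then show ?thesis
    by (simp add: ang_vel_def B_def matrix_vector_mult_def vec_eq_iff forall_3 sum_3)
qed

definition radial :: "real \<Rightarrow> real^3" where
  "radial \<phi> = vector [cos \<phi>, sin \<phi>, 0]"

definition tangential :: "real \<Rightarrow> real^3" where
  "tangential \<phi> = vector [- sin \<phi>, cos \<phi>, 0]"

lemma norm_radial [simp]: "norm (radial \<phi>) = 1"
  by (simp add: radial_def norm_vec_def L2_set_def sum_3)

lemma radial_neq_0 [simp]: "radial \<phi> \<noteq> 0"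
  using norm_radial[of \<phi>] by (metis norm_zero zero_neq_one)

lemma cross3_vertical:
  "radial \<phi> \<times> vector [0, 0, c] = - c *\<^sub>R tangential \<phi>"
  "tangential \<phi> \<times> vector [0, 0, c] = c *\<^sub>R radial \<phi>"
  by (simp_all add: cross3_def radial_def tangential_def vec_eq_iff forall_3)

lemma has_vector_derivative_vec3:
  assumes "(f has_vector_derivative f') F" "(g has_vector_derivative g') F"
    "(h has_vector_derivative h') F"
  shows "((\<lambda>t. vector [f t, g t, h t] :: real^3) has_vector_derivative vector [f', g', h']) F"
proof -
  have v: "(vector [a, b, c] :: real^3) = a *\<^sub>R axis 1 1 + b *\<^sub>R axis 2 1 + c *\<^sub>R axis 3 1"
    for a b c :: real
    by (simp add: vec_eq_iff forall_3 axis_def)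
  show ?thesis
    unfolding v using assms
    by (intro has_vector_derivative_add
        bounded_linear.has_vector_derivative[OF bounded_linear_scaleR_left])
qed

lemma has_vector_derivative_radial:
  "((\<lambda>t. radial (\<theta> * t)) has_vector_derivative \<theta> *\<^sub>R tangential (\<theta> * t)) (at t within S)"
proof -
  have *: "\<theta> *\<^sub>R tangential (\<theta> * t) = vector [- \<theta> * sin (\<theta> * t), \<theta> * cos (\<theta> * t), 0]"
    by (simp add: tangential_def vec_eq_iff forall_3)
  show ?thesis unfolding radial_def *
    by (rule has_vector_derivative_vec3)
       (auto intro!: derivative_eq_intros simp flip: has_real_derivative_iff_has_vector_derivative)
qed

lemma has_vector_derivative_tangential:
  "((\<lambda>t. tangential (\<theta> * t)) has_vector_derivative - \<theta> *\<^sub>R radial (\<theta> * t)) (at t within S)"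
proof -
  have *: "- \<theta> *\<^sub>R radial (\<theta> * t) = vector [- (\<theta> * cos (\<theta> * t)), - \<theta> * sin (\<theta> * t), 0]"
    by (simp add: radial_def vec_eq_iff forall_3)
  show ?thesis unfolding tangential_def *
    by (rule has_vector_derivative_vec3)
       (auto intro!: derivative_eq_intros simp flip: has_real_derivative_iff_has_vector_derivative)
qed

text \<open>
  The three bodies lie on a line at the angle \<open>\<phi>\<close> in the axes of \<open>S\<^sub>0\<close>, with signed size \<open>r\<close>,
  and have the velocities of a rotation at the rate \<open>w\<close> in inertial axes.
\<close>

definition circular_state ::
  "real \<Rightarrow> real \<Rightarrow> real \<Rightarrow> real^3 \<Rightarrow> real^3 \<Rightarrow> real^3 \<Rightarrow> real \<Rightarrow> real \<Rightarrow> real \<Rightarrow> state" where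
  "circular_state g1 g2 \<kappa> Pi1 Pi2 Pi0 r w \<phi> =
     (Pi1, Pi2, Pi0, r *\<^sub>R radial \<phi>, (g1 * w * r) *\<^sub>R tangential \<phi>,
      (\<kappa> * r) *\<^sub>R radial \<phi>, (g2 * w * \<kappa> * r) *\<^sub>R tangential \<phi>)"

text \<open>
  Along a circular orbit obeying Kepler's third law the field is the derivative in \<open>\<phi>\<close> times
  \<open>w - \<omega>\<close>, the rate of the orbit relative to the axes of \<open>S\<^sub>0\<close>. Both \<open>\<lambda> \<times> \<nabla>\<^sub>\<lambda>\<V>\<close> and
  \<open>\<mu> \<times> \<nabla>\<^sub>\<mu>\<V>\<close> vanish, as the gradients point along the line, so \<open>\<Pi>\<^sub>0\<close> does not move.
\<close>

lemma motion_field_circular: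
  assumes m: "m0 > 0" "m1 > 0" "m2 > 0" and I: "A0 > 0" "C0 > 0"
    and \<rho>: "\<rho> < -1" "euler_quintic m0 m1 m2 \<rho> = 0"
    and r: "r \<noteq> 0" and w: "w\<^sup>2 * \<bar>r\<bar> ^ 3 = Kepler_const G m0 m1 m2 \<rho>"
    and P: "Pi1 \<times> ang_vel A1 C1 0 Pi1 = 0" "Pi2 \<times> ang_vel A2 C2 0 Pi2 = 0"
    and g: "g1 = red_mass1 m1 m2" "g2 = red_mass2 m0 m1 m2"
    and \<kappa>: "\<kappa> = Euler_ratio m1 m2 \<rho>"
  shows "motion_field G m0 m1 m2 A0 C0 A1 C1 A2 C2 l
      (circular_state g1 g2 \<kappa> Pi1 Pi2 (vector [0, 0, C0 * \<omega> + l]) r w \<phi>) =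
    (0, 0, 0, (r * (w - \<omega>)) *\<^sub>R tangential \<phi>, - (g1 * w * r * (w - \<omega>)) *\<^sub>R radial \<phi>,
     (\<kappa> * r * (w - \<omega>)) *\<^sub>R tangential \<phi>, - (g2 * w * \<kappa> * r * (w - \<omega>)) *\<^sub>R radial \<phi>)"
proof -
  define v where "v = r *\<^sub>R radial \<phi>"
  have v: "v \<noteq> 0" "norm v = \<bar>r\<bar>" "(\<kappa> * r) *\<^sub>R radial \<phi> = \<kappa> *\<^sub>R v"
    using r by (simp_all add: v_def)
  have g0: "g1 \<noteq> 0" "g2 \<noteq> 0"
    using m by (simp_all add: g red_mass1_def red_mass2_def)
  have K: "Kepler_const G m0 m1 m2 \<rho> / norm v ^ 3 = w\<^sup>2"
    using r v w[symmetric] by simp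
  have "gradient (\<lambda>x. potential G m0 m1 m2 x (\<kappa> *\<^sub>R v)) v = (g1 * w\<^sup>2) *\<^sub>R v"
    unfolding gradient_la_Euler[OF m(2,3) \<rho>(1) v(1), of G m0, folded \<kappa> g]
    by (simp add: K flip: times_divide_eq_right)
  then have la: "gradient (\<lambda>x. potential G m0 m1 m2 x (\<kappa> *\<^sub>R v)) v = (g1 * w\<^sup>2 * r) *\<^sub>R radial \<phi>"
    by (simp add: v_def)
  have "red_mass2 m0 m1 m2 * Kepler_const G m0 m1 m2 \<rho> * Euler_ratio m1 m2 \<rho> / norm v ^ 3 =
      g2 * \<kappa> * (Kepler_const G m0 m1 m2 \<rho> / norm v ^ 3)"
    by (simp add: g \<kappa>)
  then have "gradient (\<lambda>x. potential G m0 m1 m2 v x) (\<kappa> *\<^sub>R v) = (g2 * \<kappa> * w\<^sup>2) *\<^sub>R v"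
    using gradient_mu_Euler[OF m \<rho> v(1), of G] by (simp add: K \<kappa>)
  then have mu: "gradient (\<lambda>x. potential G m0 m1 m2 v x) (\<kappa> *\<^sub>R v) =
      (g2 * \<kappa> * w\<^sup>2 * r) *\<^sub>R radial \<phi>"
    by (simp add: v_def)
  have \<Omega>0: "ang_vel A0 C0 l (vector [0, 0, C0 * \<omega> + l]) = vector [0, 0, \<omega>]"
    using I by (simp add: ang_vel_eq)
  have vert: "(vector [0, 0, C0 * \<omega> + l] :: real^3) \<times> vector [0, 0, \<omega>] = 0"
    by (simp add: cross3_def vec_eq_iff forall_3)
  show ?thesis
    unfolding motion_field_def circular_state_def v(3) v_def[symmetric] Let_def split
      P \<Omega>0 vert la mu g[symmetric]
    by (simp add: v_def cross_mult_left cross_mult_right cross3_vertical g0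
        algebra_simps power2_eq_square flip: scaleR_add_left scaleR_diff_left)
qed

lemma circular_state_in_phase_space:
  assumes "m1 + m2 \<noteq> 0" "\<rho> < -1" "r \<noteq> 0"
  shows "circular_state g1 g2 (Euler_ratio m1 m2 \<rho>) Pi1 Pi2 Pi0 r w \<phi> \<in> phase_space m1 m2"
  using assms x_vec_Euler[OF assms(1), of "r *\<^sub>R radial \<phi>" \<rho>]
  by (simp add: circular_state_def phase_space_def)

lemma circular_state_solution:
  assumes m: "m0 > 0" "m1 > 0" "m2 > 0" and I: "A0 > 0" "C0 > 0"
    and \<rho>: "\<rho> < -1" "euler_quintic m0 m1 m2 \<rho> = 0"
    and r: "r \<noteq> 0" and w: "w\<^sup>2 * \<bar>r\<bar> ^ 3 = Kepler_const G m0 m1 m2 \<rho>"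
    and P: "Pi1 \<times> ang_vel A1 C1 0 Pi1 = 0" "Pi2 \<times> ang_vel A2 C2 0 Pi2 = 0"
  shows "is_solution (motion_field G m0 m1 m2 A0 C0 A1 C1 A2 C2 l) (phase_space m1 m2) T
    (\<lambda>t. circular_state (red_mass1 m1 m2) (red_mass2 m0 m1 m2) (Euler_ratio m1 m2 \<rho>) Pi1 Pi2
      (vector [0, 0, C0 * \<omega> + l]) r w ((w - \<omega>) * t))"
proof -
  have rad: "((\<lambda>t. c *\<^sub>R radial (\<theta> * t)) has_vector_derivative
      (c * \<theta>) *\<^sub>R tangential (\<theta> * t)) (at t within S)" for c \<theta> t S
    using has_vector_derivative_scaleR[OF DERIV_const has_vector_derivative_radial, of c \<theta> t S]
    by simp
  have tan: "((\<lambda>t. c *\<^sub>R tangential (\<theta> * t)) has_vector_derivative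
      - ((c * \<theta>) *\<^sub>R radial (\<theta> * t))) (at t within S)" for c \<theta> t S
    using has_vector_derivative_scaleR[OF DERIV_const has_vector_derivative_tangential, of c \<theta> t S]
    by simp
  show ?thesis
    unfolding is_solution_def
      motion_field_circular[OF m I \<rho> r w P refl refl refl]
    using circular_state_in_phase_space[of m1 m2 \<rho> r] m \<rho> r
    unfolding circular_state_def
    by (auto intro!: has_vector_derivative_Pair has_vector_derivative_const rad tan)
qed

section \<open>Drift along the family of circular orbits\<close>

text \<open>
  Here \<open>k\<^sup>2\<close> is the scale of the nearby orbit, so that the rate prescribed by Kepler's third law is
  a rational function of \<open>k\<close>. The drift needs a rotating equilibrium: for \<open>\<omega> = 0\<close> all the
  rates \<open>\<omega> / k\<^sup>3\<close> would agree.
\<close>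

lemma circular_state_not_lyapunov_stable:
  assumes m: "m0 > 0" "m1 > 0" "m2 > 0" and I: "A0 > 0" "C0 > 0"
    and \<rho>: "\<rho> < -1" "euler_quintic m0 m1 m2 \<rho> = 0"
    and r: "r \<noteq> 0" and \<omega>: "\<omega>\<^sup>2 * \<bar>r\<bar> ^ 3 = Kepler_const G m0 m1 m2 \<rho>" "\<omega> \<noteq> 0"
    and P: "Pi1 \<times> ang_vel A1 C1 0 Pi1 = 0" "Pi2 \<times> ang_vel A2 C2 0 Pi2 = 0"
  shows "\<not> lyapunov_stable (motion_field G m0 m1 m2 A0 C0 A1 C1 A2 C2 l) (phase_space m1 m2)
    (circular_state (red_mass1 m1 m2) (red_mass2 m0 m1 m2) (Euler_ratio m1 m2 \<rho>) Pi1 Pi2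
      (vector [0, 0, C0 * \<omega> + l]) r \<omega> 0)"
    (is "\<not> lyapunov_stable ?f ?D ?e")
proof
  assume stable: "lyapunov_stable ?f ?D ?e"
  define c where "c = circular_state (red_mass1 m1 m2) (red_mass2 m0 m1 m2) (Euler_ratio m1 m2 \<rho>)
    Pi1 Pi2 (vector [0, 0, C0 * \<omega> + l])"
  have "\<bar>r\<bar> > 0" using r by simp
  with stable obtain \<delta> where \<delta>: "\<delta> > 0"
    and close: "\<And>T z t. is_solution ?f ?D T z \<Longrightarrow> dist (z 0) ?e < \<delta> \<Longrightarrow> t \<in> {0..<T} \<Longrightarrow>
      dist (z t) ?e < \<bar>r\<bar>"
    unfolding lyapunov_stable_def by metis
  have "continuous (at 1) (\<lambda>k. c (k\<^sup>2 * r) (\<omega> / k ^ 3) 0)"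
    unfolding c_def circular_state_def by (intro continuous_intros) auto
  then obtain d where d: "d > 0"
    "\<And>k. dist k 1 < d \<Longrightarrow> dist (c (k\<^sup>2 * r) (\<omega> / k ^ 3) 0) (c (1\<^sup>2 * r) (\<omega> / 1 ^ 3) 0) < \<delta>"
    using \<delta> unfolding continuous_at_eps_delta dist_norm by metis
  define k where "k = 1 + d / 2"
  have k: "k > 1" "dist k 1 < d" using d by (auto simp: k_def dist_real_def)
  define w \<theta> where "w = \<omega> / k ^ 3" and "\<theta> = w - \<omega>"
  define z where "z t = c (k\<^sup>2 * r) w (\<theta> * t)" for t
  have "k ^ 3 \<noteq> 1" using k by (metis one_less_power less_irrefl zero_less_numeral)
  then have \<theta>: "\<theta> \<noteq> 0" using \<omega>(2) k by (auto simp: \<theta>_def w_def field_simps)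
  have "w\<^sup>2 * \<bar>k\<^sup>2 * r\<bar> ^ 3 = \<omega>\<^sup>2 * \<bar>r\<bar> ^ 3"
    using k by (simp add: w_def abs_mult power_mult_distrib power_divide flip: power_mult)
  then have "is_solution ?f ?D T z" for T
    unfolding z_def c_def \<theta>_def
    using circular_state_solution[OF m I \<rho> _ _ P, of "k\<^sup>2 * r" w] r k \<omega>(1) by simp
  moreover have "dist (z 0) ?e < \<delta>"
    using d(2)[OF k(2)] by (simp add: z_def w_def c_def)
  moreover have "pi / \<bar>\<theta>\<bar> \<in> {0..<pi / \<bar>\<theta>\<bar> + 1}" by simp
  ultimately have "dist (z (pi / \<bar>\<theta>\<bar>)) ?e < \<bar>r\<bar>" by (rule close)
  moreover have "\<bar>r\<bar> \<le> dist (z (pi / \<bar>\<theta>\<bar>)) ?e"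
  proof -
    have "cos (\<theta> * (pi / \<bar>\<theta>\<bar>)) = -1" "sin (\<theta> * (pi / \<bar>\<theta>\<bar>)) = 0"
      using \<theta> by (cases "\<theta> > 0"; simp)+
    then have half_turn: "radial (\<theta> * (pi / \<bar>\<theta>\<bar>)) = - radial 0"
      by (simp add: radial_def vec_eq_iff forall_3)
    have "\<bar>r\<bar> \<le> norm (- (k\<^sup>2 * r + r) *\<^sub>R radial 0)"
      proof -
        have "k\<^sup>2 * r + r = (k\<^sup>2 + 1) * r" by (simp add: algebra_simps)
        then show ?thesis
          using mult_right_mono[of 1 "k\<^sup>2 + 1" "\<bar>r\<bar>"] by (simp add: abs_mult)
      qed
    also have "\<dots> = dist ((k\<^sup>2 * r) *\<^sub>R radial (\<theta> * (pi / \<bar>\<theta>\<bar>))) (r *\<^sub>R radial 0)"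
      unfolding half_turn dist_norm
      by (rule arg_cong[where f = norm]) (simp add: scaleR_diff_left scaleR_add_left)
    also have "\<dots> = dist (fst (snd (snd (snd (z (pi / \<bar>\<theta>\<bar>)))))) (fst (snd (snd (snd ?e))))"
      by (simp add: z_def c_def circular_state_def)
    also have "\<dots> \<le> dist (z (pi / \<bar>\<theta>\<bar>)) ?e"
      by (meson dist_fst_le dist_snd_le order_trans)
    finally show ?thesis .
  qed
  ultimately show False by simp
qed

theorem proposition13:
  fixes G m0 m1 m2 A0 C0 A1 C1 A2 C2 l :: real
    and \<rho> le mue \<omega>e :: real
    and Pi1e Pi2e :: "real^3"
    and ze :: state
  assumes "G > 0"
    and "m0 > 0" and "m1 > 0" and "m2 > 0"
    and "A0 > 0" and "C0 > 0" and "A1 > 0" and "C1 > 0" and "A2 > 0" and "C2 > 0"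
    and "C1 = A1" and "C2 = A2"
    and "\<bar>le\<bar> > 0"
    and "\<rho> < -1" and "euler_quintic m0 m1 m2 \<rho> = 0"
    and "mue = ((1 + \<rho>) * m2 + \<rho> * m1) / (m1 + m2) * le"
    and "\<omega>e\<^sup>2 = G * (m1 + m2) / \<bar>le\<bar>^3 *
           (1 + m0 / (m1 + m2) * (1 / \<rho>\<^sup>2 - 1 / (1 + \<rho>)\<^sup>2))"
    and "Pi1e \<times> ang_vel A1 C1 0 Pi1e = 0"
    and "Pi2e \<times> ang_vel A2 C2 0 Pi2e = 0"
    and "ze = (Pi1e, Pi2e,
           vector [0, 0, C0 * \<omega>e + l],
           vector [le, 0, 0],
           vector [0, red_mass1 m1 m2 * \<omega>e * le, 0],
           vector [mue, 0, 0],
           vector [0, red_mass2 m0 m1 m2 * \<omega>e * mue, 0])"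
  shows "eulerian_relative_equilibrium G m0 m1 m2 A0 C0 A1 C1 A2 C2 l ze \<and>
         configuration_S0_S2_S1 m1 m2 ze \<and>
         unstable_equilibrium (motion_field G m0 m1 m2 A0 C0 A1 C1 A2 C2 l) (phase_space m1 m2) ze"
proof -
  let ?f = "motion_field G m0 m1 m2 A0 C0 A1 C1 A2 C2 l"
  let ?\<kappa> = "Euler_ratio m1 m2 \<rho>"
  have le: "le \<noteq> 0" using assms by simp
  have M: "m1 + m2 \<noteq> 0" using assms by simp
  have Kepler: "\<omega>e\<^sup>2 * \<bar>le\<bar> ^ 3 = Kepler_const G m0 m1 m2 \<rho>"
    using le by (simp add: assms(17) Kepler_const_def)
  have mue: "mue = ?\<kappa> * le" by (simp add: assms(16) Euler_ratio_def)
  have vec: "vector [a, 0, 0] = a *\<^sub>R radial 0" "vector [0, a, 0] = a *\<^sub>R tangential 0" for a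
    by (simp_all add: radial_def tangential_def vec_eq_iff forall_3)
  have ze: "ze = circular_state (red_mass1 m1 m2) (red_mass2 m0 m1 m2) ?\<kappa> Pi1e Pi2e
      (vector [0, 0, C0 * \<omega>e + l]) le \<omega>e 0"
    unfolding assms(20) circular_state_def vec mue by (simp add: mult.assoc)
  have "\<omega>e \<noteq> 0"
  proof
    \<comment> \<open>Without rotation the attraction of \<open>S\<^sub>1\<close> and \<open>S\<^sub>2\<close> on \<open>S\<^sub>0\<close> would have to cancel,
      although both pull to the same side.\<close>
    assume "\<omega>e = 0"
    then have "G * m0 * (m1 / \<rho>\<^sup>2 + m2 / (1 + \<rho>)\<^sup>2) = 0"
      using Kepler Euler_force_balance[of m0 m1 m2 \<rho> G] assms(2-4,14,15) by simp
    moreover have "m1 / \<rho>\<^sup>2 + m2 / (1 + \<rho>)\<^sup>2 > 0"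
      using assms(3,4,14) by (intro add_pos_pos divide_pos_pos) auto
    ultimately show False using assms(1,2) by simp
  qed
  then have unstable: "\<not> lyapunov_stable ?f (phase_space m1 m2) ze"
    unfolding ze
    using circular_state_not_lyapunov_stable[OF assms(2-6,14,15) le Kepler] assms(18,19) by blast
  have "?f ze = 0"
    unfolding ze
    using motion_field_circular[OF assms(2-6,14,15) le Kepler assms(18,19) refl refl refl]
    by (simp add: zero_prod_def)
  moreover have "ze \<in> phase_space m1 m2"
    unfolding ze using circular_state_in_phase_space[OF M assms(14) le] .
  ultimately have eq: "equilibrium ?f (phase_space m1 m2) ze"
    by (simp add: equilibrium_def)
  have "collinear {0, le *\<^sub>R radial 0, (?\<kappa> * le) *\<^sub>R radial 0}"
    unfolding collinear_lemma by (metis scaleR_scaleR)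
  moreover have "ang_vel A0 C0 l (vector [0, 0, C0 * \<omega>e + l]) = vector [0, 0, \<omega>e]"
    using assms(5,6) by (simp add: ang_vel_eq)
  moreover have "orthogonal (vector [0, 0, \<omega>e]) (a *\<^sub>R radial 0)" for a
    by (simp add: orthogonal_def radial_def inner_vec_def sum_3)
  ultimately have "eulerian_relative_equilibrium G m0 m1 m2 A0 C0 A1 C1 A2 C2 l ze"
    using eq by (simp add: eulerian_relative_equilibrium_def ze circular_state_def)
  moreover have "configuration_S0_S2_S1 m1 m2 ze"
  proof -
    define u where "u = (1 + \<rho>) / \<rho>"
    have u: "0 < u" "u < 1" "u * \<rho> = 1 + \<rho>"
      using assms(14) by (auto simp: u_def field_simps)
    have "- ((1 + \<rho>) *\<^sub>R v) \<in> open_segment 0 (- (\<rho> *\<^sub>R v))" if "v \<noteq> 0" for v :: "real^3"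
      using u that assms(14) by (auto simp: in_segment intro!: exI[of _ u])
    from this[of "le *\<^sub>R radial 0"] show ?thesis
      using le x_vec_Euler[OF M, of "le *\<^sub>R radial 0" \<rho>]
      by (simp add: configuration_S0_S2_S1_def ze circular_state_def)
  qed
  ultimately show ?thesis
    using eq unstable by (simp add: unstable_equilibrium_def)
qed

end
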